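(* Set $\delta_j(t)=(1-c_{j+1}(t))c_j(t)$ for $j=0,\ldots,n-1$, and define the following subsets of $I$: $$\mathsf{D}^{\uparrow}_{\max}=\{t\in I\mid \delta_j'(t)>0\ \text{ for all } j\in\{0,\ldots,n-1\}\},\qquad \mathsf{D}^{\downarrow}_{\max}=\{t\in I\mid \delta_j'(t)<0\ \text{ for all } j\in\{0,\ldots,n-1\}\}.$$ Then $\lambda_{\max}(B,t)$ is a strictly increasing (resp., strictly decreasing) function of $t$ in each one of the non-degenerate subintervals of $\mathsf{D}^{\uparrow}_{\max}$ (resp., $\mathsf{D}^{\downarrow}_{\max}$).
   Context: Let $n$ be a positive integer, $I\subseteq\mathbb{R}$ a non-empty open interval, and let $a_0,\ldots,a_n,b_0,\ldots,b_n:I\to\mathbb{R}$ be continuously differentiable functions with, for all $t\in I$, $a_j(t)>0$ for $j=0,\ldots,n$, $b_j(t)>0$ for $j=1,\ldots,n$, and $b_0(t)\ge 0$. Put $c_j(t)=\dfrac{a_j(t)}{a_j(t)+b_j(t)}$ for $j=0,\ldots,n$. The prime denotes differentiation with respect to $t$. The random walk matrix $B(t)$ is the $(n+1)\times(n+1)$ tridiagonal matrix (rows and columns indexed by $0,\ldots,n$) with zero diagonal, superdiagonal entries $B(t)_{j,j+1}=c_j(t)$ and subdiagonal entries $B(t)_{j+1,j}=1-c_{j+1}(t)$ for $0\le j\le n-1$, and zeros elsewhere. Its eigenvalues are real and simple, and $\lambda_{\max}(B,t)$ denotes the largest one. *)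

theory Defs
  imports "HOL-Analysis.Analysis" "Jordan_Normal_Form.Spectral_Radius"
begin

definition rw_c :: "(nat \<Rightarrow> real \<Rightarrow> real) \<Rightarrow> (nat \<Rightarrow> real \<Rightarrow> real) \<Rightarrow> nat \<Rightarrow> real \<Rightarrow> real" where
  "rw_c a b j t = a j t / (a j t + b j t)"

definition rw_matrix ::
  "nat \<Rightarrow> (nat \<Rightarrow> real \<Rightarrow> real) \<Rightarrow> (nat \<Rightarrow> real \<Rightarrow> real) \<Rightarrow> real \<Rightarrow> real mat" where
  "rw_matrix n a b t = Matrix.mat (n + 1) (n + 1)
     (\<lambda>(i, j). if j = i + 1 then rw_c a b i t
               else if i = j + 1 then 1 - rw_c a b i t
               else 0)"

text \<open>The set \<open>spectrum A\<close> consists of the eigenvalues in the base field, here the real ones.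
  The eigenvalues of a random walk matrix are all real, so nothing is lost.\<close>

definition lambda_max :: "real mat \<Rightarrow> real" where
  "lambda_max A = Max (spectrum A)"

definition rw_delta :: "(nat \<Rightarrow> real \<Rightarrow> real) \<Rightarrow> (nat \<Rightarrow> real \<Rightarrow> real) \<Rightarrow> nat \<Rightarrow> real \<Rightarrow> real" where
  "rw_delta a b j t = (1 - rw_c a b (j + 1) t) * rw_c a b j t"

definition D_up_max ::
  "nat \<Rightarrow> (nat \<Rightarrow> real \<Rightarrow> real) \<Rightarrow> (nat \<Rightarrow> real \<Rightarrow> real) \<Rightarrow> real set \<Rightarrow> real set" where
  "D_up_max n a b I = {t \<in> I. \<forall>j<n. deriv (rw_delta a b j) t > 0}"

definition D_down_max ::
  "nat \<Rightarrow> (nat \<Rightarrow> real \<Rightarrow> real) \<Rightarrow> (nat \<Rightarrow> real \<Rightarrow> real) \<Rightarrow> real set \<Rightarrow> real set" where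
  "D_down_max n a b I = {t \<in> I. \<forall>j<n. deriv (rw_delta a b j) t < 0}"

definition nondegenerate_interval :: "real set \<Rightarrow> bool" where
  "nondegenerate_interval J \<longleftrightarrow> is_interval J \<and> (\<exists>x\<in>J. \<exists>y\<in>J. x < y)"

end

theory Submission
  imports Defs
begin

text \<open>The spectrum of a tridiagonal matrix with zero diagonal depends only on the products \<open>\<delta> j\<close> of
  opposite off-diagonal entries. Indeed, when the superdiagonal has no zeros, the rows of the
  eigenvalue equation determine an eigenvector from its first entry, the entries being multiples of
  the continuants \<open>p k\<close> given by \<open>p (k + 2) = x * p (k + 1) - \<delta> k * p k\<close>; the last row then says
  that \<open>p (n + 1)\<close> vanishes at \<open>x\<close> (lemma \<open>eigenvalue_tridiagonal_iff\<close>).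

  The ratios \<open>r k = p (k + 1) / p k\<close> satisfy \<open>r (k + 1) = x - \<delta> k / r k\<close>. As long as they stay
  positive, they grow when \<open>x\<close> grows and when the \<open>\<delta> k\<close> shrink (lemma \<open>continuant_ratio_growth\<close>).
  The largest root of \<open>p (n + 1)\<close> is the point where \<open>r n\<close> vanishes and the earlier ratios are
  positive; such a point exists by the intermediate value theorem (lemma \<open>ex_positive_root\<close>), and it
  is the largest root because \<open>r n\<close> is positive to its right. If all \<open>\<delta> k\<close> are decreased strictly,
  then \<open>r n\<close> becomes positive at this point too, and to its right. Hence the largest eigenvalue is
  strictly increasing in \<open>\<delta>\<close> (lemma \<open>lambda_max_rw_matrix_less\<close>). The mean value theorem turns
  the sign of the derivatives of the \<open>\<delta> j\<close> into strict monotonicity along each interval.\<close>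

(* The dollar sign denotes entries of Jordan_Normal_Form vectors below, not of vectors
  indexed by a finite type. *)
unbundle no vec_syntax

section \<open>Continuants\<close>

fun continuant :: "(nat \<Rightarrow> real) \<Rightarrow> real \<Rightarrow> nat \<Rightarrow> real" where
  "continuant d x 0 = 1"
| "continuant d x (Suc 0) = x"
| "continuant d x (Suc (Suc k)) = x * continuant d x (Suc k) - d k * continuant d x k"

lemma continuous_on_continuant: "continuous_on S (\<lambda>x. continuant d x k)"
  by (induction k rule: induct_nat_012) (auto intro!: continuous_on_diff continuous_on_mult)

text \<open>One step of the recursion for the ratios, with denominators cleared. The last summand on the
  right is the gain from replacing \<open>d k\<close> by \<open>e k\<close>.\<close>

lemma continuant_ratio_step:
  assumes ratio: "continuant e y (Suc k) * continuant d x k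
      \<ge> (continuant d x (Suc k) + (y - x) * continuant d x k) * continuant e y k"
    and pos: "continuant d x k > 0" "continuant d x (Suc k) > 0" "continuant e y k > 0"
    and "x \<le> y" "0 \<le> d k"
  shows "continuant e y (Suc (Suc k)) * continuant d x (Suc k)
      \<ge> (continuant d x (Suc (Suc k)) + (y - x) * continuant d x (Suc k)) * continuant e y (Suc k)
         + (d k - e k) * continuant e y k * continuant d x (Suc k)"
proof -
  have "0 \<le> (y - x) * continuant d x k * continuant e y k"
    using assms by simp
  then have "continuant d x (Suc k) * continuant e y k \<le> continuant e y (Suc k) * continuant d x k"
    using ratio by (simp add: algebra_simps)
  then have "d k * (continuant d x (Suc k) * continuant e y k)
      \<le> d k * (continuant e y (Suc k) * continuant d x k)"
    using \<open>0 \<le> d k\<close> by (rule mult_left_mono)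
  then show ?thesis
    by (simp add: algebra_simps)
qed

text \<open>In \<open>r (k + 1) = x - d k / r k\<close> a larger \<open>r k\<close>, a smaller \<open>d k\<close> and a larger \<open>x\<close> all push
  \<open>r (k + 1)\<close> up, and \<open>x\<close> does so at unit rate even without the help of \<open>r k\<close>; this is where the
  term \<open>y - x\<close> comes from. The two claims need a joint induction, since the lower bound for
  \<open>r k\<close> gives the positivity of the next continuant.\<close>

lemma continuant_ratio_growth:
  assumes "\<And>j. j \<le> k \<Longrightarrow> continuant d x j > 0"
    and "x \<le> y"
    and "\<And>j. j < k \<Longrightarrow> 0 \<le> e j \<and> e j \<le> d j"
  shows "continuant e y k > 0"
    and "continuant e y (Suc k) * continuant d x k
      \<ge> (continuant d x (Suc k) + (y - x) * continuant d x k) * continuant e y k"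
  using assms
proof (induction k)
  case 0
  {
    case 1
    show ?case by simp
  next
    case 2
    show ?case by simp
  }
next
  case (Suc k)
  {
    case 1
    have pos: "continuant d x k > 0" "continuant d x (Suc k) > 0" "continuant e y k > 0"
      using 1 Suc.IH(1) by auto
    have "(continuant d x (Suc k) + (y - x) * continuant d x k) * continuant e y k > 0"
      using pos 1(2) by (intro mult_pos_pos add_pos_nonneg mult_nonneg_nonneg) auto
    also have "\<dots> \<le> continuant e y (Suc k) * continuant d x k"
      using Suc.IH(2) 1 by auto
    finally show ?case
      using pos(1) by (simp add: zero_less_mult_iff)
  next
    case 2
    have pos: "continuant d x k > 0" "continuant d x (Suc k) > 0" "continuant e y k > 0"
      using 2 Suc.IH(1) by auto
    have e: "0 \<le> d k" "e k \<le> d k"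
      using 2(3)[of k] by auto
    have "0 \<le> (d k - e k) * continuant e y k * continuant d x (Suc k)"
      using pos e by simp
    moreover have ratio: "continuant e y (Suc k) * continuant d x k
        \<ge> (continuant d x (Suc k) + (y - x) * continuant d x k) * continuant e y k"
      using Suc.IH(2) 2 by auto
    ultimately show ?case
      using continuant_ratio_step[OF ratio pos \<open>x \<le> y\<close> e(1)] by linarith
  }
qed

text \<open>At the root the last ratio is zero. It becomes positive either through the gain \<open>y - x\<close> or
  through the decrease of the last coefficient. With \<open>e = d\<close> this shows
  that \<open>x\<close> is the largest root; with \<open>e < d\<close> it compares the largest roots.\<close>

lemma continuant_pos_beyond_root:
  assumes root: "continuant d x (Suc n) = 0"
    and pos: "\<And>j. j \<le> n \<Longrightarrow> continuant d x j > 0"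
    and "x \<le> y"
    and le: "\<And>j. j < n \<Longrightarrow> 0 \<le> e j \<and> e j \<le> d j"
    and strict: "x < y \<or> (n \<ge> 1 \<and> e (n - 1) < d (n - 1))"
  shows "continuant e y (Suc n) > 0"
proof -
  have "0 < continuant d x n" using pos by simp
  have "0 < continuant e y n"
    by (rule continuant_ratio_growth(1)[OF pos \<open>x \<le> y\<close> le]) auto
  have "0 < continuant e y (Suc n) * continuant d x n"
  proof (cases "x < y")
    case True
    have "0 < (continuant d x (Suc n) + (y - x) * continuant d x n) * continuant e y n"
      using True root \<open>0 < continuant d x n\<close> \<open>0 < continuant e y n\<close> by simp
    also have "\<dots> \<le> continuant e y (Suc n) * continuant d x n"
      by (rule continuant_ratio_growth(2)[OF pos \<open>x \<le> y\<close> le]) auto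
    finally show ?thesis .
  next
    case False
    then obtain m where m: "n = Suc m" "e m < d m"
      using strict by (cases n) auto
    have xm: "0 < continuant d x m" and xSm: "0 < continuant d x (Suc m)"
      using pos m by auto
    have pos': "\<And>j. j \<le> m \<Longrightarrow> continuant d x j > 0"
      and le': "\<And>j. j < m \<Longrightarrow> 0 \<le> e j \<and> e j \<le> d j"
      using pos le m(1) by auto
    have ym: "0 < continuant e y m"
      by (rule continuant_ratio_growth(1)[of m d x, OF pos' \<open>x \<le> y\<close> le'])
    have ratio: "continuant e y (Suc m) * continuant d x m
        \<ge> (continuant d x (Suc m) + (y - x) * continuant d x m) * continuant e y m"
      by (rule continuant_ratio_growth(2)[of m d x, OF pos' \<open>x \<le> y\<close> le'])
    have "0 < (continuant d x (Suc n) + (y - x) * continuant d x n) * continuant e y n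
        + (d m - e m) * continuant e y m * continuant d x n"
      using False \<open>x \<le> y\<close> root m ym xSm by simp
    also have "\<dots> \<le> continuant e y (Suc n) * continuant d x n"
      using continuant_ratio_step[OF ratio xm xSm ym \<open>x \<le> y\<close>] le[of m] unfolding m(1) by linarith
    finally show ?thesis .
  qed
  then show ?thesis
    using \<open>0 < continuant d x n\<close> by (simp add: zero_less_mult_iff)
qed

text \<open>A root \<open>x\<close> of this kind of one continuant leads to one of the next: at \<open>x\<close> the next continuant is
  \<open>- d n * p n < 0\<close>, and far to the right it is positive. The bound \<open>0 \<le> x\<close> serves
  only to make the point where it is positive explicit.\<close>

lemma ex_positive_root:
  assumes "\<And>j. j < n \<Longrightarrow> d j > 0"
  shows "\<exists>x\<ge>0. continuant d x (Suc n) = 0 \<and> (\<forall>j\<le>n. continuant d x j > 0)"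
  using assms
proof (induction n)
  case 0
  show ?case by (intro exI[of _ 0]) simp
next
  case (Suc n)
  then obtain x where x: "0 \<le> x" "continuant d x (Suc n) = 0"
    and pos: "\<And>j. j \<le> n \<Longrightarrow> continuant d x j > 0"
    by auto
  have dn: "0 < d n" and d: "\<And>j. j < n \<Longrightarrow> 0 \<le> d j \<and> d j \<le> d j"
    using Suc.prems by (auto simp: less_imp_le)
  define y where "y = x + 1 + d n"
  have "x \<le> y" using dn by (simp add: y_def)
  have yn: "0 < continuant d y n"
    by (rule continuant_ratio_growth(1)[OF pos \<open>x \<le> y\<close> d]) auto
  have "((y - x) * continuant d y n) * continuant d x n \<le> continuant d y (Suc n) * continuant d x n"
    using continuant_ratio_growth(2)[of n d x y d, OF pos \<open>x \<le> y\<close> d] x(2)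
    by (simp add: mult_ac del: continuant.simps)
  then have "(1 + d n) * continuant d y n \<le> continuant d y (Suc n)"
    using pos[of n] by (simp add: y_def)
  then have "y * ((1 + d n) * continuant d y n) \<le> y * continuant d y (Suc n)"
    using \<open>0 \<le> x\<close> \<open>x \<le> y\<close> by (intro mult_left_mono) auto
  moreover have "d n < y * (1 + d n)"
  proof -
    have "1 * (1 + d n) \<le> y * (1 + d n)"
      using dn \<open>0 \<le> x\<close> by (intro mult_right_mono) (auto simp: y_def)
    then show ?thesis by simp
  qed
  then have "d n * continuant d y n < y * (1 + d n) * continuant d y n"
    using yn by (rule mult_strict_right_mono)
  ultimately have "0 < continuant d y (Suc (Suc n))"
    by (simp add: mult.assoc)
  moreover have "continuant d x (Suc (Suc n)) < 0"
    using x pos[of n] dn by simp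
  ultimately obtain z where z: "x \<le> z" "continuant d z (Suc (Suc n)) = 0"
    using IVT'[of "\<lambda>x. continuant d x (Suc (Suc n))" x 0 y] \<open>x \<le> y\<close> continuous_on_continuant
    by (metis less_imp_le)
  have "x < z"
    using z \<open>continuant d x (Suc (Suc n)) < 0\<close> by (cases "x = z") auto
  have "0 < continuant d z j" if "j \<le> Suc n" for j
  proof (cases "j = Suc n")
    case True
    then show ?thesis
      using continuant_pos_beyond_root[OF x(2) pos z(1) d] \<open>x < z\<close> by auto
  next
    case False
    then show ?thesis
      using that d pos by (intro continuant_ratio_growth(1)[OF _ z(1)]) auto
  qed
  then show ?case
    using z \<open>0 \<le> x\<close> by (intro exI[of _ z]) auto
qed

section \<open>Eigenvalues of tridiagonal matrices with zero diagonal\<close>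

definition tridiagonal :: "nat \<Rightarrow> (nat \<Rightarrow> real) \<Rightarrow> (nat \<Rightarrow> real) \<Rightarrow> real mat" where
  "tridiagonal n u l = Matrix.mat (n + 1) (n + 1)
     (\<lambda>(i, j). if j = i + 1 then u i else if i = j + 1 then l i else 0)"

lemma tridiagonal_carrier: "tridiagonal n u l \<in> carrier_mat (n + 1) (n + 1)"
  by (simp add: tridiagonal_def)

lemma tridiagonal_mult_vec_nth:
  assumes "i \<le> n" "v \<in> carrier_vec (n + 1)"
  shows "(tridiagonal n u l *\<^sub>v v) $ i
    = (if i < n then u i * v $ (i + 1) else 0) + (if 0 < i then l i * v $ (i - 1) else 0)"
proof -
  have "(tridiagonal n u l *\<^sub>v v) $ i
      = (\<Sum>j<n + 1. (if j = i + 1 then u i else if i = j + 1 then l i else 0) * v $ j)"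
    using assms by (auto simp: tridiagonal_def scalar_prod_def atLeast0LessThan intro!: sum.cong)
  also have "\<dots> = (\<Sum>j<n + 1. (if j = i + 1 then u i * v $ (i + 1) else 0)
      + (if j = i - 1 then (if 0 < i then l i * v $ (i - 1) else 0) else 0))"
    by (intro sum.cong) auto
  also have "\<dots> = (if i < n then u i * v $ (i + 1) else 0)
      + (if 0 < i then l i * v $ (i - 1) else 0)"
    using assms(1) by (auto simp: sum.distrib)
  finally show ?thesis .
qed

text \<open>The first \<open>n\<close> rows of the eigenvalue equation force
  \<open>v k = v 0 * p k / (u 0 * \<dots> * u (k - 1))\<close>, and the last row holds exactly if \<open>p (n + 1)\<close>
  vanishes.\<close>

lemma eigenvalue_tridiagonal_iff:
  assumes u: "\<And>j. j < n \<Longrightarrow> u j \<noteq> 0"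
  shows "eigenvalue (tridiagonal n u l) x \<longleftrightarrow> continuant (\<lambda>j. u j * l (j + 1)) x (Suc n) = 0"
proof -
  let ?A = "tridiagonal n u l"
  have dim: "dim_row ?A = n + 1"
    by (simp add: tridiagonal_def)
  define p where "p = continuant (\<lambda>j. u j * l (j + 1)) x"
  define U where "U k = (\<Prod>j<k. u j)" for k
  have U: "U k \<noteq> 0" if "k \<le> n" for k
    using that u by (auto simp: U_def)
  have US: "U (Suc k) = U k * u k" for k
    by (simp add: U_def)
  have p: "p 0 = 1" "p (Suc 0) = x"
    "p (Suc (Suc k)) = x * p (Suc k) - u k * l (Suc k) * p k" for k
    by (simp_all add: p_def)
  have row: "(?A *\<^sub>v v) $ i = x * v $ i \<longleftrightarrow>
      (if i < n then u i * v $ (i + 1) else 0) + (if 0 < i then l i * v $ (i - 1) else 0)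
        = x * v $ i" if "i \<le> n" "v \<in> carrier_vec (n + 1)" for i v
    using tridiagonal_mult_vec_nth[OF that] by simp
  have "p (Suc n) = 0" if eig: "eigenvalue ?A x"
  proof -
    obtain v where v: "v \<in> carrier_vec (n + 1)" "v \<noteq> 0\<^sub>v (n + 1)" "?A *\<^sub>v v = x \<cdot>\<^sub>v v"
      using eig unfolding eigenvalue_def eigenvector_def dim by blast
    have rowv: "(if i < n then u i * v $ (i + 1) else 0)
        + (if 0 < i then l i * v $ (i - 1) else 0) = x * v $ i" if "i \<le> n" for i
      using row[OF that v(1)] v that by auto
    have vU: "v $ k * U k = v $ 0 * p k" if "k \<le> n" for k
      using that
    proof (induction k rule: induct_nat_012)
      case 0
      show ?case by (simp add: U_def p)
    next
      case 1
      then show ?case using rowv[of 0] by (simp add: U_def p algebra_simps)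
    next
      case (ge2 k)
      have "u (Suc k) * v $ (Suc (Suc k)) = x * v $ (Suc k) - l (Suc k) * v $ k"
        using rowv[of "Suc k"] ge2.prems by simp
      then have "v $ (Suc (Suc k)) * U (Suc (Suc k))
          = (x * v $ (Suc k) - l (Suc k) * v $ k) * U (Suc k)"
        by (simp add: US[of "Suc k"] mult_ac)
      also have "\<dots> = x * (v $ (Suc k) * U (Suc k)) - u k * l (Suc k) * (v $ k * U k)"
        by (simp add: US algebra_simps)
      also have "\<dots> = v $ 0 * p (Suc (Suc k))"
        using ge2 by (simp add: p algebra_simps)
      finally show ?case .
    qed
    have "v $ 0 \<noteq> 0"
    proof
      assume "v $ 0 = 0"
      then have "v = 0\<^sub>v (n + 1)"
        using v(1) vU U by (intro eq_vecI) auto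
      with v(2) show False by simp
    qed
    moreover have "v $ 0 * p (Suc n) = 0"
    proof (cases n)
      case 0
      then show ?thesis using rowv[of 0] by (auto simp: p)
    next
      case (Suc m)
      have last: "l (Suc m) * v $ m = x * v $ (Suc m)"
        using rowv[of n] Suc by simp
      have "v $ 0 * p (Suc n) = x * (v $ (Suc m) * U (Suc m)) - u m * l (Suc m) * (v $ m * U m)"
        using vU[of m] vU[of "Suc m"] Suc by (simp add: p algebra_simps)
      also have "\<dots> = (x * v $ (Suc m) - l (Suc m) * v $ m) * U (Suc m)"
        by (simp add: US algebra_simps)
      finally show ?thesis using last by simp
    qed
    ultimately show ?thesis by simp
  qed
  moreover have "eigenvalue ?A x" if root: "p (Suc n) = 0"
  proof -
    define v where "v = Matrix.vec (n + 1) (\<lambda>k. p k / U k)"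
    have v: "v \<in> carrier_vec (n + 1)" "\<And>k. k \<le> n \<Longrightarrow> v $ k = p k / U k"
      by (auto simp: v_def)
    have "v $ 0 = 1" by (simp add: v U_def p)
    then have "v \<noteq> 0\<^sub>v (n + 1)" by auto
    moreover have "?A *\<^sub>v v = x \<cdot>\<^sub>v v"
    proof (rule eq_vecI)
      fix i assume "i < dim_vec (x \<cdot>\<^sub>v v)"
      then have i: "i \<le> n" by (simp add: v_def)
      \<comment> \<open>Multiplied by \<open>U i\<close>, row \<open>i\<close> is the recursion for the continuants; for \<open>i = n\<close> the
        missing entry of \<open>v\<close> is accounted for by \<open>p (n + 1) = 0\<close>.\<close>
      have up: "(if i < n then u i * v $ (i + 1) else 0) = p (Suc i) / U i"
      proof (cases "i < n")
        case True
        then show ?thesis using u[of i] by (simp add: v US)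
      next
        case False
        then show ?thesis using i root by simp
      qed
      have down: "(if 0 < i then l i * v $ (i - 1) else 0) = (x * p i - p (Suc i)) / U i"
      proof (cases i)
        case 0
        then show ?thesis by (simp add: p)
      next
        case (Suc m)
        then show ?thesis using i u[of m] by (simp add: v US p)
      qed
      have "(?A *\<^sub>v v) $ i = x * v $ i"
        unfolding row[OF i v(1)] up down by (simp add: v(2)[OF i] diff_divide_distrib)
      then show "(?A *\<^sub>v v) $ i = (x \<cdot>\<^sub>v v) $ i"
        using i by (simp add: v_def)
    qed (simp add: v_def tridiagonal_def)
    ultimately show ?thesis
      using v(1) unfolding eigenvalue_def eigenvector_def by (auto simp: dim)
  qed
  ultimately show ?thesis
    unfolding p_def by blast
qed

text \<open>This characterises the largest eigenvalue by the signs of the continuants, so that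
  matrices with different products \<open>u j * l (j + 1)\<close> can be compared by \<open>continuant_pos_beyond_root\<close>.\<close>

lemma lambda_max_tridiagonal:
  assumes u: "\<And>j. j < n \<Longrightarrow> u j \<noteq> 0"
    and d: "\<And>j. j < n \<Longrightarrow> u j * l (j + 1) > 0"
  defines "L \<equiv> lambda_max (tridiagonal n u l)"
  shows "continuant (\<lambda>j. u j * l (j + 1)) L (Suc n) = 0"
    and "\<And>j. j \<le> n \<Longrightarrow> continuant (\<lambda>j. u j * l (j + 1)) L j > 0"
proof -
  let ?d = "\<lambda>j. u j * l (j + 1)"
  obtain x where x: "continuant ?d x (Suc n) = 0"
    and pos: "\<And>j. j \<le> n \<Longrightarrow> continuant ?d x j > 0"
    using ex_positive_root[of n ?d] d by blast
  have spec: "spectrum (tridiagonal n u l) = {y. continuant ?d y (Suc n) = 0}"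
    unfolding spectrum_def by (intro Collect_cong eigenvalue_tridiagonal_iff u)
  have "y \<le> x" if "continuant ?d y (Suc n) = 0" for y
  proof (rule ccontr)
    assume "\<not> y \<le> x"
    then have "0 < continuant ?d y (Suc n)"
      using x pos d by (intro continuant_pos_beyond_root[of ?d x]) (auto simp: less_imp_le)
    with that show False by simp
  qed
  then have "L = x"
    unfolding L_def lambda_max_def
    using card_finite_spectrum(1)[OF tridiagonal_carrier[of n u l]] x by (intro Max_eqI) (auto simp: spec)
  then show "continuant ?d L (Suc n) = 0" "\<And>j. j \<le> n \<Longrightarrow> continuant ?d L j > 0"
    using x pos by auto
qed

section \<open>Random walk matrices\<close>

text \<open>At the largest eigenvalue for \<open>t\<close> the signs of the continuants for \<open>t\<close> are known. The
  smaller products at \<open>s\<close> make the last continuant for \<open>s\<close> positive there and beyond, so no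
  eigenvalue for \<open>s\<close> reaches that far.\<close>

lemma lambda_max_rw_matrix_less:
  assumes "n \<ge> 1"
    and c: "\<And>j. j < n \<Longrightarrow> rw_c a b j s > 0" "\<And>j. j < n \<Longrightarrow> rw_c a b j t > 0"
    and d: "\<And>j. j < n \<Longrightarrow> 0 < rw_delta a b j s" "\<And>j. j < n \<Longrightarrow> rw_delta a b j s < rw_delta a b j t"
  shows "lambda_max (rw_matrix n a b s) < lambda_max (rw_matrix n a b t)"
proof -
  let ?L = "\<lambda>r. lambda_max (rw_matrix n a b r)"
  have mat: "rw_matrix n a b r = tridiagonal n (\<lambda>j. rw_c a b j r) (\<lambda>j. 1 - rw_c a b j r)" for r
    by (simp add: rw_matrix_def tridiagonal_def)
  have delta: "(\<lambda>j. rw_c a b j r * (1 - rw_c a b (j + 1) r)) = (\<lambda>j. rw_delta a b j r)" for r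
    by (simp add: rw_delta_def mult.commute)
  have root: "continuant (\<lambda>j. rw_delta a b j r) (?L r) (Suc n) = 0"
    and pos: "\<And>j. j \<le> n \<Longrightarrow> continuant (\<lambda>j. rw_delta a b j r) (?L r) j > 0"
    if c: "\<And>j. j < n \<Longrightarrow> rw_c a b j r > 0" and d: "\<And>j. j < n \<Longrightarrow> 0 < rw_delta a b j r" for r
  proof -
    have u: "rw_c a b j r \<noteq> 0" if "j < n" for j
      using c[OF that] by simp
    have ul: "rw_c a b j r * (1 - rw_c a b (j + 1) r) > 0" if "j < n" for j
      using d[OF that] by (simp add: rw_delta_def mult.commute)
    show "continuant (\<lambda>j. rw_delta a b j r) (?L r) (Suc n) = 0"
      and "\<And>j. j \<le> n \<Longrightarrow> continuant (\<lambda>j. rw_delta a b j r) (?L r) j > 0"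
      unfolding mat delta[symmetric]
      using lambda_max_tridiagonal[of n "\<lambda>j. rw_c a b j r" "\<lambda>j. 1 - rw_c a b j r", OF u ul]
      by blast+
  qed
  have dt: "0 < rw_delta a b j t" if "j < n" for j
    using d(1)[OF that] d(2)[OF that] by simp
  show ?thesis
  proof (rule ccontr)
    assume "\<not> ?L s < ?L t"
    then have "?L t \<le> ?L s" by simp
    have "0 < continuant (\<lambda>j. rw_delta a b j s) (?L s) (Suc n)"
    proof (rule continuant_pos_beyond_root[OF root[OF c(2) dt] pos[OF c(2) dt] \<open>?L t \<le> ?L s\<close>])
      show "0 \<le> rw_delta a b j s \<and> rw_delta a b j s \<le> rw_delta a b j t" if "j < n" for j
        using d(1)[OF that] d(2)[OF that] by simp
      show "?L t < ?L s \<or> (n \<ge> 1 \<and> rw_delta a b (n - 1) s < rw_delta a b (n - 1) t)"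
        using d(2)[of "n - 1"] \<open>n \<ge> 1\<close> by simp
    qed
    with root[OF c(1) d(1)] show False by simp
  qed
qed

lemma rw_c_differentiable:
  assumes "a j C1_differentiable_on I" "b j C1_differentiable_on I" "t \<in> I" "a j t + b j t \<noteq> 0"
  shows "(\<lambda>t. rw_c a b j t) differentiable (at t)"
proof -
  have "a j differentiable (at t)" "b j differentiable (at t)"
    using assms by (auto simp: C1_differentiable_on_eq)
  then show ?thesis
    unfolding rw_c_def using assms(4) by (intro differentiable_divide differentiable_add)
qed

theorem proposition5p1:
  fixes n :: nat and I :: "real set" and a b :: "nat \<Rightarrow> real \<Rightarrow> real"
  assumes n_pos: "n \<ge> 1"
    and I: "I \<noteq> {}" "open I" "is_interval I"
    and a_C1: "\<And>j. j \<le> n \<Longrightarrow> a j C1_differentiable_on I"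
    and b_C1: "\<And>j. j \<le> n \<Longrightarrow> b j C1_differentiable_on I"
    and a_pos: "\<And>j t. j \<le> n \<Longrightarrow> t \<in> I \<Longrightarrow> a j t > 0"
    and b_pos: "\<And>j t. 1 \<le> j \<Longrightarrow> j \<le> n \<Longrightarrow> t \<in> I \<Longrightarrow> b j t > 0"
    and b0_nonneg: "\<And>t. t \<in> I \<Longrightarrow> b 0 t \<ge> 0"
  shows "(\<forall>J. nondegenerate_interval J \<and> J \<subseteq> D_up_max n a b I \<longrightarrow>
             strict_mono_on J (\<lambda>t. lambda_max (rw_matrix n a b t)))
       \<and> (\<forall>J. nondegenerate_interval J \<and> J \<subseteq> D_down_max n a b I \<longrightarrow>
             strict_antimono_on J (\<lambda>t. lambda_max (rw_matrix n a b t)))"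
proof -
  have ab: "a j t + b j t > 0" if "j \<le> n" "t \<in> I" for j t
    using that a_pos[of j t] b_pos[of j t] b0_nonneg[of t] by (cases "j = 0") fastforce+
  have c_pos: "rw_c a b j t > 0" if "j \<le> n" "t \<in> I" for j t
    using that ab a_pos by (simp add: rw_c_def)
  have c_less: "rw_c a b j t < 1" if "1 \<le> j" "j \<le> n" "t \<in> I" for j t
    using that ab[of j t] b_pos[of j t] by (simp add: rw_c_def)
  have delta_pos: "rw_delta a b j t > 0" if "j < n" "t \<in> I" for j t
    using that c_pos[of j t] c_less[of "j + 1" t] by (simp add: rw_delta_def)
  have "(\<lambda>t. rw_delta a b j t) differentiable (at t)" if "j < n" "t \<in> I" for j t
    unfolding rw_delta_def
    using that ab[of j t] ab[of "j + 1" t] a_C1 b_C1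
    by (intro differentiable_mult differentiable_diff differentiable_const rw_c_differentiable[where I = I])
      auto
  then have DERIV: "(rw_delta a b j has_real_derivative deriv (rw_delta a b j) t) (at t)"
    if "j < n" "t \<in> I" for j t
    using that by (simp add: DERIV_deriv_iff_real_differentiable)
  have between: "r \<in> J" if "nondegenerate_interval J" "s \<in> J" "t \<in> J" "s \<le> r" "r \<le> t"
    for J and r s t :: real
    using that unfolding nondegenerate_interval_def is_interval_1 by blast
  show ?thesis
  proof (intro conjI allI impI)
    fix J
    assume J: "nondegenerate_interval J \<and> J \<subseteq> D_up_max n a b I"
    show "strict_mono_on J (\<lambda>t. lambda_max (rw_matrix n a b t))"
    proof (rule strict_mono_onI)
      fix s t assume st: "s \<in> J" "t \<in> J" "s < t"
      have sub: "r \<in> D_up_max n a b I" if "s \<le> r" "r \<le> t" for r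
        using between[of J s t r] J st that by blast
      have "rw_delta a b j s < rw_delta a b j t" if "j < n" for j
        using st(3)
      proof (rule DERIV_pos_imp_increasing)
        fix r assume "s \<le> r" "r \<le> t"
        then show "\<exists>y. (rw_delta a b j has_real_derivative y) (at r) \<and> 0 < y"
          using sub[of r] that DERIV[of j r] unfolding D_up_max_def by blast
      qed
      moreover have "s \<in> I" "t \<in> I"
        using J st unfolding D_up_max_def by auto
      ultimately show "lambda_max (rw_matrix n a b s) < lambda_max (rw_matrix n a b t)"
        using n_pos c_pos delta_pos by (intro lambda_max_rw_matrix_less) auto
    qed
  next
    fix J
    assume J: "nondegenerate_interval J \<and> J \<subseteq> D_down_max n a b I"
    show "strict_antimono_on J (\<lambda>t. lambda_max (rw_matrix n a b t))"
    proof (rule monotone_onI)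
      fix s t assume st: "s \<in> J" "t \<in> J" "s < t"
      have sub: "r \<in> D_down_max n a b I" if "s \<le> r" "r \<le> t" for r
        using between[of J s t r] J st that by blast
      have "rw_delta a b j s > rw_delta a b j t" if "j < n" for j
        using st(3)
      proof (rule DERIV_neg_imp_decreasing)
        fix r assume "s \<le> r" "r \<le> t"
        then show "\<exists>y. (rw_delta a b j has_real_derivative y) (at r) \<and> y < 0"
          using sub[of r] that DERIV[of j r] unfolding D_down_max_def by blast
      qed
      moreover have "s \<in> I" "t \<in> I"
        using J st unfolding D_down_max_def by auto
      ultimately show "lambda_max (rw_matrix n a b s) > lambda_max (rw_matrix n a b t)"
        using n_pos c_pos delta_pos by (intro lambda_max_rw_matrix_less) auto
    qed
  qed
qed

end
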